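(* Let $m, d$ be positive integers with $d > 1$ and $1 \le m \le d$. Then $$\dim_H(E_{m,d}) = \frac{\log m}{\log d}.$$
   Context: $S^1 = \mathbb{R}/\mathbb{Z}$. For a positive integer $d$, the $d$-map is the map $S^1 \to S^1$, $x \mapsto dx \pmod 1$. Cycle: for $d>1$, a finite set $C \subset S^1$ is a cycle for the $d$-map if the $d$-map restricted to $C$ is a transitive permutation of $C$ (i.e. it permutes $C$ in a single orbit). Degree of a cycle: $\deg(C)$ is the smallest non-negative integer $m$ for which there exists a degree-$m$ map $f: S^1 \to S^1$ such that $f$ and the $d$-map agree on $C$. Here a degree-$m$ map means a continuous, weakly orientation-preserving (monotone) map of topological degree $m$, i.e. a map $f$ having a continuous non-decreasing lift $\tilde f : \mathbb{R} \to \mathbb{R}$ with $\tilde f(x+1) = \tilde f(x) + m$ for all $x$. For $d>1$ and $1 \le m \le d$, $E_{m,d}$ is the closure in $S^1$ of the set of all points $c \in S^1$ that belong to some cycle of degree $m$ for the $d$-map. $\dim_H$ denotes Hausdorff dimension: $\dim_H(E) = \inf\{\delta \ge 0 : \inf\{\sum_i r_i^{\delta} : E \subset \bigcup_i B(x_i, r_i)\} = 0\}$, the inner infimum being over countable covers by balls. *)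

theory Defs
  imports "HOL-Analysis.Analysis"
begin

quotient_type circle = real / "\<lambda>x y :: real. x - y \<in> \<int>"
proof (rule equivpI)
  show "reflp (\<lambda>x y :: real. x - y \<in> \<int>)"
    by (auto simp: reflp_def)
  show "symp (\<lambda>x y :: real. x - y \<in> \<int>)"
    by (auto simp: symp_def) (metis Ints_minus minus_diff_eq)
  show "transp (\<lambda>x y :: real. x - y \<in> \<int>)"
    unfolding transp_def by (metis Ints_add diff_add_cancel add_diff_eq)
qed

lift_definition circle_proj :: "real \<Rightarrow> circle" is "\<lambda>x. x" .

lemma circle_proj_eq_iff: "circle_proj x = circle_proj y \<longleftrightarrow> x - y \<in> \<int>"
  by transfer simp

lemma circle_proj_surj: obtains x where "c = circle_proj x"
proof -
  have "\<exists>x. c = circle_proj x"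
    by transfer (metis Ints_0 diff_self)
  with that show thesis by blast
qed

lemma infdist_Ints_attained:
  fixes x :: real
  obtains n where "n \<in> \<int>" "infdist x \<int> = \<bar>x - n\<bar>"
proof -
  have "closed (\<int> :: real set)" "(\<int> :: real set) \<noteq> {}"
    by (auto intro: Ints_0)
  from infdist_attains_inf[OF this, of x] that show thesis
    by (auto simp: dist_real_def)
qed

lemma infdist_Ints_le:
  fixes x :: real
  assumes "n \<in> \<int>"
  shows "infdist x \<int> \<le> \<bar>x - n\<bar>"
  using infdist_le[OF assms, of x] by (simp add: dist_real_def)

lemma infdist_Ints_cong:
  fixes x y :: real
  assumes "x - y \<in> \<int>"
  shows "infdist x \<int> = infdist y \<int>"
proof (rule antisym)
  obtain n where n: "n \<in> \<int>" "infdist y \<int> = \<bar>y - n\<bar>" by (rule infdist_Ints_attained)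
  have "x - y + n \<in> \<int>" using assms n by simp
  from infdist_Ints_le[OF this, of x] n show "infdist x \<int> \<le> infdist y \<int>" by simp
next
  obtain n where n: "n \<in> \<int>" "infdist x \<int> = \<bar>x - n\<bar>" by (rule infdist_Ints_attained)
  have "n - (x - y) \<in> \<int>" using assms n by simp
  from infdist_Ints_le[OF this, of y] n show "infdist y \<int> \<le> infdist x \<int>" by simp
qed

instantiation circle :: metric_space
begin

(* The quotient metric: the least distance between representatives of the two classes. *)
lift_definition dist_circle :: "circle \<Rightarrow> circle \<Rightarrow> real" is "\<lambda>x y. infdist (x - y) \<int>"
proof -
  fix x x' y y' :: real
  assume "x - x' \<in> \<int>" "y - y' \<in> \<int>"
  then have "(x - x') - (y - y') \<in> \<int>" by (rule Ints_diff)
  then have "(x - y) - (x' - y') \<in> \<int>" by (simp add: algebra_simps)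
  then show "infdist (x - y) \<int> = infdist (x' - y') \<int>" by (rule infdist_Ints_cong)
qed

definition uniformity_circle :: "(circle \<times> circle) filter" where
  "uniformity_circle = (INF e\<in>{0<..}. principal {(x, y). dist x y < e})"

definition open_circle :: "circle set \<Rightarrow> bool" where
  "open_circle U \<longleftrightarrow> (\<forall>x\<in>U. eventually (\<lambda>(x', y). x' = x \<longrightarrow> y \<in> U) uniformity)"

instance
proof
  show "uniformity = (INF e\<in>{0<..}. principal {(x :: circle, y). dist x y < e})"
    by (rule uniformity_circle_def)
  show "open U \<longleftrightarrow> (\<forall>x\<in>U. \<forall>\<^sub>F (x', y) in uniformity. x' = x \<longrightarrow> y \<in> U)" for U :: "circle set"
    by (rule open_circle_def)
  show "dist x y = 0 \<longleftrightarrow> x = y" for x y :: circle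
  proof transfer
    fix x y :: real
    have "closed (\<int> :: real set)" "(\<int> :: real set) \<noteq> {}"
      by (auto intro: Ints_0)
    from in_closed_iff_infdist_zero[OF this, of "x - y"]
    show "infdist (x - y) \<int> = 0 \<longleftrightarrow> x - y \<in> \<int>" by simp
  qed
  show "dist x y \<le> dist x z + dist y z" for x y z :: circle
  proof transfer
    fix x y z :: real
    obtain a where a: "a \<in> \<int>" "infdist (x - z) \<int> = \<bar>x - z - a\<bar>" by (rule infdist_Ints_attained)
    obtain b where b: "b \<in> \<int>" "infdist (y - z) \<int> = \<bar>y - z - b\<bar>" by (rule infdist_Ints_attained)
    have "infdist (x - y) \<int> \<le> \<bar>x - y - (a - b)\<bar>"
      using a b by (intro infdist_Ints_le) simp
    also have "\<dots> \<le> \<bar>x - z - a\<bar> + \<bar>y - z - b\<bar>" by simp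
    finally show "infdist (x - y) \<int> \<le> infdist (x - z) \<int> + infdist (y - z) \<int>"
      using a b by simp
  qed
qed

end

lemma dist_circle_proj: "dist (circle_proj x) (circle_proj y) = infdist (x - y) \<int>"
  by transfer simp

lift_definition dmap :: "nat \<Rightarrow> circle \<Rightarrow> circle" is "\<lambda>d x. real d * x"
  by (metis Ints_mult Ints_of_nat right_diff_distrib)

definition cycle :: "nat \<Rightarrow> circle set \<Rightarrow> bool" where
  "cycle d C \<longleftrightarrow> finite C \<and> C \<noteq> {} \<and> bij_betw (dmap d) C C \<and>
     (\<forall>x\<in>C. \<forall>y\<in>C. \<exists>k. (dmap d ^^ k) x = y)"

(* A continuous weakly monotone circle map of topological degree m, given by its lift F;
   continuity of f is a consequence of that of F.  For m = 0 these are the constant maps. *)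
definition degree_map :: "nat \<Rightarrow> (circle \<Rightarrow> circle) \<Rightarrow> bool" where
  "degree_map m f \<longleftrightarrow> (\<exists>F :: real \<Rightarrow> real.
     continuous_on UNIV F \<and> mono F \<and> (\<forall>x. F (x + 1) = F x + real m) \<and>
     (\<forall>x. f (circle_proj x) = circle_proj (F x)))"

lemma degree_map_dmap: "degree_map d (dmap d)"
  unfolding degree_map_def
  by (intro exI[of _ "\<lambda>x. real d * x"] conjI allI)
    (auto intro!: continuous_intros monoI mult_left_mono simp: distrib_left dmap.abs_eq circle_proj.abs_eq)

(* The minimum is attained, since dmap d itself has degree d. *)
definition cycle_degree :: "nat \<Rightarrow> circle set \<Rightarrow> nat" where
  "cycle_degree d C = (LEAST m. \<exists>f. degree_map m f \<and> (\<forall>x\<in>C. f x = dmap d x))"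

definition cycle_closure :: "nat \<Rightarrow> nat \<Rightarrow> circle set" where
  "cycle_closure m d = closure {c. \<exists>C. cycle d C \<and> cycle_degree d C = m \<and> c \<in> C}"

(* Covers are indexed by arbitrary subsets of the naturals, so that finite covers are
   included; this matters for the exponent 0, where every ball contributes 1. *)
definition hausdorff_content :: "real \<Rightarrow> 'a :: metric_space set \<Rightarrow> ennreal" where
  "hausdorff_content \<delta> A = Inf {(\<Sum>\<^sub>\<infinity>i\<in>I. ennreal (r i powr \<delta>)) | (I :: nat set) x r.
     (\<forall>i\<in>I. r i > 0) \<and> A \<subseteq> (\<Union>i\<in>I. ball (x i) (r i))}"

definition hausdorff_dim :: "'a :: metric_space set \<Rightarrow> ereal" where
  "hausdorff_dim A = Inf {ereal \<delta> | \<delta>. 0 \<le> \<delta> \<and> hausdorff_content \<delta> A = 0}"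

end

theory Submission
  imports Defs
begin

text \<open>
  Upper bound. Let \<open>C\<close> be a cycle on which the \<open>d\<close>-map agrees with a monotone map of degree at most
  \<open>m\<close>, with lift \<open>F\<close>. A point \<open>x\<close> of \<open>C\<close> is determined up to \<open>d ^ -L\<close> by the integer parts of
  \<open>F\<^sup>i x\<close> and \<open>d * F\<^sup>i x\<close> for \<open>i \<le> L\<close>. These are monotone in \<open>x\<close>, so \<open>C\<close> has only \<open>O(L m\<^sup>L)\<close> words of
  length \<open>L\<close>, uniformly in \<open>C\<close>. For fixed \<open>L\<close> there are finitely many possible sets of words, and
  each of them confines its cycles to a Cantor set of dimension at most
  \<open>ln (O(L m\<^sup>L)) / (L ln d)\<close>; now let \<open>L\<close> grow.

  Lower bound. Rewriting base \<open>m\<close> expansions in base \<open>d\<close> is a map \<open>g\<close> with \<open>d g(t) = g(m t)\<close> modulo 1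
  whose inverse is Hoelder of exponent \<open>ln m / ln d\<close>. Rational \<open>t\<close> with purely periodic expansion go to cycles
  of degree at most \<open>m\<close>, so \<open>g\<close> maps \<open>[0,1)\<close> into the closure of these cycles. If the Hausdorff
  content of the degree \<open>m\<close> part vanished at an exponent below \<open>ln m / ln d\<close>, its preimage would be
  a null set; by the upper bound so is the preimage of the closure of the cycles of degree at
  most \<open>m - 1\<close>, and together they cover \<open>[0,1)\<close>.
\<close>

section \<open>Words of cycles of low degree\<close>

lemma dmap_proj: "dmap d (circle_proj x) = circle_proj (real d * x)"
  by (simp add: dmap.abs_eq circle_proj.abs_eq)

lemma dmap_funpow_proj: "(dmap d ^^ i) (circle_proj x) = circle_proj (real d ^ i * x)"
  by (induction i) (simp_all add: dmap_proj mult_ac)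

lemma lift_add_nat:
  fixes F :: "real \<Rightarrow> real"
  assumes "\<And>x. F (x + 1) = F x + real m"
  shows "F (x + real n) = F x + real (m * n)"
proof (induction n)
  case (Suc n)
  have "F (x + real (Suc n)) = F (x + real n + 1)" by (simp add: add_ac)
  also have "\<dots> = F x + real (m * n) + real m" using Suc assms by simp
  finally show ?case by (simp add: algebra_simps)
qed simp

lemma lift_funpow_add_1:
  fixes F :: "real \<Rightarrow> real"
  assumes "\<And>x. F (x + 1) = F x + real m"
  shows "(F ^^ i) (x + 1) = (F ^^ i) x + real (m ^ i)"
proof (induction i)
  case (Suc i)
  then show ?case using lift_add_nat[of F m "(F ^^ i) x" "m ^ i", OF assms] by simp
qed simp

lemma card_image_le_if_factors:
  assumes "finite (T ` Y)" and "\<And>x y. x \<in> Y \<Longrightarrow> y \<in> Y \<Longrightarrow> T x = T y \<Longrightarrow> f x = f y"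
  shows "card (f ` Y) \<le> card (T ` Y)"
proof (rule surj_card_le[OF assms(1)])
  show "f ` Y \<subseteq> (\<lambda>v. f (inv_into Y T v)) ` T ` Y"
  proof
    fix z assume "z \<in> f ` Y"
    then obtain y where y: "y \<in> Y" "z = f y" by auto
    have "inv_into Y T (T y) \<in> Y" "T (inv_into Y T (T y)) = T y"
      using y by (auto intro: inv_into_into f_inv_into_f)
    then have "z = f (inv_into Y T (T y))" using assms(2) y by metis
    then show "z \<in> (\<lambda>v. f (inv_into Y T v)) ` T ` Y" using y by auto
  qed
qed

text \<open>Degrees are only bounded by \<open>M\<close>: the counting needs no more, and periodic
  expansions give no more. The exact degree is recovered by discarding the cycles of degree at most
  \<open>m - 1\<close>.\<close>

definition low_degree_points :: "nat \<Rightarrow> nat \<Rightarrow> circle set" where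
  "low_degree_points M d = {c. \<exists>C m f. cycle d C \<and> c \<in> C \<and> m \<le> M \<and> degree_map m f \<and> (\<forall>x\<in>C. f x = dmap d x)}"

definition unit_lift :: "circle set \<Rightarrow> real set" where
  "unit_lift C = {x. 0 \<le> x \<and> x < 1 \<and> circle_proj x \<in> C}"

text \<open>For \<open>u\<close>, \<open>v\<close> the \<open>i\<close>-th iterates of
  \<open>x\<close>, \<open>y\<close>, the integer \<open>(F v - F u) - d * (v - u)\<close> is a
  difference of two numbers in \<open>[0, 1)\<close>, hence \<open>0\<close>. So each step expands
  the gap exactly by \<open>d\<close>, and one common integer translation takes the
  \<open>L\<close>-th iterates to \<open>d ^ L * x\<close> and \<open>d ^ L * y\<close>.\<close>

lemma floor_eq_if_itinerary_eq:
  fixes F :: "real \<Rightarrow> real"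
  assumes mono: "mono F"
    and agree: "\<And>x. circle_proj x \<in> C \<Longrightarrow> circle_proj (F x) = dmap d (circle_proj x)"
    and inv: "\<And>c. c \<in> C \<Longrightarrow> dmap d c \<in> C"
    and x: "circle_proj x \<in> C" and y: "circle_proj y \<in> C" and le: "x \<le> y"
    and eq: "\<And>i. i \<le> L \<Longrightarrow> \<lfloor>(F ^^ i) x\<rfloor> = \<lfloor>(F ^^ i) y\<rfloor>"
            "\<And>i. i \<le> L \<Longrightarrow> \<lfloor>real d * (F ^^ i) x\<rfloor> = \<lfloor>real d * (F ^^ i) y\<rfloor>"
  shows "\<lfloor>real d ^ L * x\<rfloor> = \<lfloor>real d ^ L * y\<rfloor>"
proof -
  have in_C: "circle_proj ((F ^^ i) z) \<in> C \<and> circle_proj ((F ^^ i) z) = circle_proj (real d ^ i * z)"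
    if "circle_proj z \<in> C" for i z
  proof (induction i)
    case (Suc i)
    have step: "circle_proj ((F ^^ Suc i) z) = dmap d (circle_proj ((F ^^ i) z))"
      by (simp add: agree[OF conjunct1[OF Suc]])
    have "circle_proj ((F ^^ Suc i) z) \<in> C"
      unfolding step by (rule inv[OF conjunct1[OF Suc]])
    moreover have "circle_proj ((F ^^ Suc i) z) = circle_proj (real d ^ Suc i * z)"
      unfolding step conjunct2[OF Suc] dmap_proj by (simp add: mult_ac)
    ultimately show ?case ..
  qed (use that in simp)
  have mono_i: "(F ^^ i) x \<le> (F ^^ i) y" for i
    using monoD[OF mono_pow[OF mono] le] by simp
  have diff: "real d ^ i * (y - x) = (F ^^ i) y - (F ^^ i) x" if "i \<le> L" for i
    using that
  proof (induction i)
    case (Suc i)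
    define u v where "u = (F ^^ i) x" and "v = (F ^^ i) y"
    have "F u - real d * u \<in> \<int>" "F v - real d * v \<in> \<int>"
      using agree in_C[OF x, of i] in_C[OF y, of i] unfolding u_def v_def
      by (simp_all add: dmap_proj circle_proj_eq_iff)
    then have "(F v - real d * v) - (F u - real d * u) \<in> \<int>" by (rule Ints_diff[rotated])
    then obtain k where k: "(F v - real d * v) - (F u - real d * u) = of_int k"
      by (auto elim: Ints_cases)
    have "F u \<le> F v" "u \<le> v" using mono_i[of "Suc i"] mono_i[of i] by (simp_all add: u_def v_def)
    moreover have "\<lfloor>F u\<rfloor> = \<lfloor>F v\<rfloor>" "\<lfloor>real d * u\<rfloor> = \<lfloor>real d * v\<rfloor>"
      using eq(1)[of "Suc i"] eq(2)[of i] Suc.prems by (simp_all add: u_def v_def)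
    moreover have "real d * u \<le> real d * v" using \<open>u \<le> v\<close> by (simp add: mult_left_mono)
    ultimately have "of_int k < (1 :: real)" "of_int k > (-1 :: real)" using k by linarith+
    then have "k = 0" by linarith
    then have "F v - F u = real d * (v - u)" using k by (simp add: algebra_simps)
    moreover have "real d ^ i * (y - x) = v - u" using Suc by (simp add: u_def v_def)
    ultimately show ?case by (simp add: u_def v_def mult_ac)
  qed simp
  have "real d ^ L * x - (F ^^ L) x \<in> \<int>"
    using in_C[OF x, of L] circle_proj_eq_iff by metis
  then obtain k where k: "real d ^ L * x = (F ^^ L) x + of_int k"
    by (metis Ints_cases add.commute diff_add_cancel)
  moreover have "real d ^ L * y = (F ^^ L) y + of_int k"
    using diff[of L] k by (simp add: algebra_simps)
  ultimately show ?thesis using eq(1)[of L] by simp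
qed

text \<open>The itinerary of \<open>x\<close>, and with it the word, is a function of one integer
  \<open>T x\<close>. This integer is monotone and increases from \<open>0\<close> to
  \<open>1\<close> by a number depending only on \<open>m\<close>, \<open>d\<close> and
  \<open>L\<close>, which bounds the number of words uniformly in \<open>C\<close>.\<close>

lemma card_words_le:
  assumes C: "cycle d C" and f: "degree_map m f" "\<And>c. c \<in> C \<Longrightarrow> f c = dmap d c"
    and m: "m \<le> M" "1 \<le> M"
  shows "card ((\<lambda>x. \<lfloor>real d ^ L * x\<rfloor>) ` unit_lift C) \<le> (1 + d) * (L + 1) * M ^ L + 1"
proof -
  obtain F where F: "mono F" "\<And>x. F (x + 1) = F x + real m"
      "\<And>x. f (circle_proj x) = circle_proj (F x)"
    using f(1) unfolding degree_map_def by metis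
  \<comment> \<open>Being monotone in each summand, \<open>T\<close> determines all the floors in it, hence the itinerary of \<open>x\<close>.\<close>
  define T where "T x = (\<Sum>i\<le>L. \<lfloor>(F ^^ i) x\<rfloor> + \<lfloor>real d * (F ^^ i) x\<rfloor>)" for x
  have mono_i: "(F ^^ i) x \<le> (F ^^ i) y" if "x \<le> y" for i x y
    using monoD[OF mono_pow[OF F(1)] that] by simp
  have floor_add_nat: "\<lfloor>z + real n\<rfloor> = \<lfloor>z\<rfloor> + int n" for z n by linarith
  have term_mono: "\<lfloor>(F ^^ i) x\<rfloor> \<le> \<lfloor>(F ^^ i) y\<rfloor>" "\<lfloor>real d * (F ^^ i) x\<rfloor> \<le> \<lfloor>real d * (F ^^ i) y\<rfloor>"
    if "x \<le> y" for i x y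
    using mono_i[OF that, of i] by (auto intro!: floor_mono mult_left_mono)
  have T_mono: "T x \<le> T y" if "x \<le> y" for x y
    unfolding T_def using term_mono[OF that] by (intro sum_mono add_mono)
  have "T 1 = (\<Sum>i\<le>L. \<lfloor>(F ^^ i) 0\<rfloor> + \<lfloor>real d * (F ^^ i) 0\<rfloor> + int ((1 + d) * m ^ i))"
    unfolding T_def
  proof (rule sum.cong)
    fix i
    have 1: "(F ^^ i) 1 = (F ^^ i) 0 + real (m ^ i)"
      using lift_funpow_add_1[of F m i 0, OF F(2)] by simp
    have 2: "real d * (F ^^ i) 1 = real d * (F ^^ i) 0 + real (d * m ^ i)"
      unfolding 1 by (simp add: algebra_simps)
    have "\<lfloor>(F ^^ i) 1\<rfloor> = \<lfloor>(F ^^ i) 0\<rfloor> + int (m ^ i)"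
      by (subst 1) (rule floor_add_nat)
    moreover have "\<lfloor>real d * (F ^^ i) 1\<rfloor> = \<lfloor>real d * (F ^^ i) 0\<rfloor> + int (d * m ^ i)"
      by (subst 2) (rule floor_add_nat)
    ultimately show "\<lfloor>(F ^^ i) 1\<rfloor> + \<lfloor>real d * (F ^^ i) 1\<rfloor> =
        \<lfloor>(F ^^ i) 0\<rfloor> + \<lfloor>real d * (F ^^ i) 0\<rfloor> + int ((1 + d) * m ^ i)"
      by (simp add: algebra_simps)
  qed simp
  also have "\<dots> = T 0 + int (\<Sum>i\<le>L. (1 + d) * m ^ i)"
    by (simp add: T_def sum.distrib)
  finally have T1: "T 1 = T 0 + int (\<Sum>i\<le>L. (1 + d) * m ^ i)" .
  \<comment> \<open>Bounding each summand by the largest costs a factor \<open>L + 1\<close>,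
    harmless for the exponential growth rate. Since \<open>m\<close> may be \<open>0\<close>, the
    increasing powers are those of \<open>M\<close>.\<close>
  have "(1 + d) * m ^ i \<le> (1 + d) * M ^ L" if "i \<le> L" for i
  proof -
    have "m ^ i \<le> M ^ i" using m by (simp add: power_mono)
    also have "\<dots> \<le> M ^ L" using m that by (simp add: power_increasing)
    finally show ?thesis by (rule mult_le_mono2)
  qed
  then have "(\<Sum>i\<le>L. (1 + d) * m ^ i) \<le> (\<Sum>i\<le>L. (1 + d) * M ^ L)" by (intro sum_mono) simp
  then have S: "(\<Sum>i\<le>L. (1 + d) * m ^ i) \<le> (1 + d) * (L + 1) * M ^ L" by (simp add: algebra_simps)
  have sub: "T ` unit_lift C \<subseteq> {T 0..T 1}" by (auto simp: unit_lift_def intro!: T_mono)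
  have fin: "finite (T ` unit_lift C)" using sub finite_subset by blast
  have "card ((\<lambda>x. \<lfloor>real d ^ L * x\<rfloor>) ` unit_lift C) \<le> card (T ` unit_lift C)"
  proof (rule card_image_le_if_factors[OF fin])
    have *: "\<lfloor>real d ^ L * x\<rfloor> = \<lfloor>real d ^ L * y\<rfloor>"
      if xy: "x \<in> unit_lift C" "y \<in> unit_lift C" "T x = T y" "x \<le> y" for x y
    proof -
      have eq: "\<lfloor>(F ^^ i) x\<rfloor> + \<lfloor>real d * (F ^^ i) x\<rfloor> = \<lfloor>(F ^^ i) y\<rfloor> + \<lfloor>real d * (F ^^ i) y\<rfloor>"
        if "i \<le> L" for i
        using sum_mono_inv[OF xy(3)[unfolded T_def], of i] term_mono[OF xy(4)] that
        by (simp add: add_mono)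
      show ?thesis
      proof (rule floor_eq_if_itinerary_eq[OF F(1)])
        show "circle_proj (F z) = dmap d (circle_proj z)" if "circle_proj z \<in> C" for z
          using F(3) f(2)[OF that] by simp
        show "dmap d c \<in> C" if "c \<in> C" for c
          using C that by (auto simp: cycle_def bij_betw_def)
        show "\<lfloor>(F ^^ i) x\<rfloor> = \<lfloor>(F ^^ i) y\<rfloor>" "\<lfloor>real d * (F ^^ i) x\<rfloor> = \<lfloor>real d * (F ^^ i) y\<rfloor>"
          if "i \<le> L" for i
          using eq[OF that] term_mono[OF xy(4), of i] by linarith+
      qed (use xy in \<open>auto simp: unit_lift_def\<close>)
    qed
    show "\<lfloor>real d ^ L * x\<rfloor> = \<lfloor>real d ^ L * y\<rfloor>"
      if "x \<in> unit_lift C" "y \<in> unit_lift C" "T x = T y" for x y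
      using *[OF that] *[OF that(2,1) that(3)[symmetric], symmetric] linear[of x y] by blast
  qed
  also have "\<dots> \<le> card {T 0..T 1}" using sub by (intro card_mono) auto
  also have "\<dots> = (\<Sum>i\<le>L. (1 + d) * m ^ i) + 1"
    unfolding T1 card_atLeastAtMost_int by linarith
  finally show ?thesis using S by linarith
qed

section \<open>Covering the cycles of low degree\<close>

text \<open>The integers whose \<open>p\<close> digits in base \<open>D\<close>, leading zeros included, all lie in \<open>W\<close>.\<close>

fun base_words :: "int set \<Rightarrow> int \<Rightarrow> nat \<Rightarrow> int set" where
  "base_words W D 0 = {0}"
| "base_words W D (Suc p) = (\<lambda>(j, w). D * j + w) ` (base_words W D p \<times> W)"

lemma finite_base_words: "finite W \<Longrightarrow> finite (base_words W D p)"
  by (induction p) auto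

lemma card_base_words_le: "finite W \<Longrightarrow> card (base_words W D p) \<le> card W ^ p"
proof (induction p)
  case (Suc p)
  have "card (base_words W D (Suc p)) \<le> card (base_words W D p \<times> W)"
    unfolding base_words.simps using Suc.prems
    by (intro card_image_le finite_cartesian_product finite_base_words)
  also have "\<dots> \<le> card W ^ p * card W"
    using Suc by (simp add: card_cartesian_product)
  finally show ?case by (simp add: mult.commute)
qed simp

text \<open>By invariance of \<open>C\<close>, the fractional part of \<open>D ^ p * x\<close> is
  again a lift of a point of \<open>C\<close>, so the next block of \<open>L\<close> digits of
  \<open>x\<close> is a word of \<open>C\<close>.\<close>

lemma floor_in_base_words:
  fixes L :: nat
  assumes inv: "\<And>c. c \<in> C \<Longrightarrow> dmap d c \<in> C" and x: "x \<in> unit_lift C"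
  defines "W \<equiv> (\<lambda>x. \<lfloor>real d ^ L * x\<rfloor>) ` unit_lift C"
  shows "\<lfloor>(real d ^ L) ^ p * x\<rfloor> \<in> base_words W (int d ^ L) p"
proof (induction p)
  case 0
  then show ?case using x by (auto simp: unit_lift_def intro!: floor_unique)
next
  case (Suc p)
  define D where "D = real d ^ L"
  define z where "z = D ^ p * x"
  have D: "D = of_int (int d ^ L)" by (simp add: D_def)
  have "(dmap d ^^ i) c \<in> C" if "c \<in> C" for i c
    using inv that by (induction i) auto
  then have "(dmap d ^^ (L * p)) (circle_proj x) \<in> C" using x by (simp add: unit_lift_def)
  then have "circle_proj z \<in> C"
    by (simp add: dmap_funpow_proj z_def D_def power_mult)
  moreover have "circle_proj (frac z) = circle_proj z"
    unfolding circle_proj_eq_iff by (simp add: frac_def)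
  ultimately have "frac z \<in> unit_lift C" by (simp add: unit_lift_def frac_ge_0 frac_lt_1)
  then have w: "\<lfloor>D * frac z\<rfloor> \<in> W" by (auto simp: W_def D_def)
  have "D ^ Suc p * x = of_int (int d ^ L * \<lfloor>z\<rfloor>) + D * frac z"
    by (simp add: z_def frac_def D algebra_simps)
  then have "\<lfloor>D ^ Suc p * x\<rfloor> = int d ^ L * \<lfloor>z\<rfloor> + \<lfloor>D * frac z\<rfloor>" by linarith
  then show ?case using Suc w unfolding z_def D_def[symmetric] by force
qed

lemma hausdorff_content_le_finite:
  fixes A :: "'a :: metric_space set"
  assumes "finite S" "r > 0" "A \<subseteq> (\<Union>s\<in>S. ball (c s) r)"
  shows "hausdorff_content \<delta> A \<le> ennreal (real (card S) * r powr \<delta>)"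
proof -
  define n where "n = card S"
  obtain b where "bij_betw b {..<n} S"
    using ex_bij_betw_nat_finite[OF assms(1)] by (auto simp: atLeast0LessThan n_def)
  then have b: "b ` {..<n} = S" by (simp add: bij_betw_def)
  have "A \<subseteq> (\<Union>i\<in>{..<n}. ball (c (b i)) r)"
    using assms(3) unfolding b[symmetric] by simp
  then have "hausdorff_content \<delta> A \<le> (\<Sum>\<^sub>\<infinity>i\<in>{..<n}. ennreal (r powr \<delta>))"
    unfolding hausdorff_content_def
    by (intro Inf_lower CollectI exI[of _ "{..<n}"] exI[of _ "\<lambda>i. c (b i)"] exI[of _ "\<lambda>i. r"])
       (use assms(2) in auto)
  also have "\<dots> = ennreal (real (card S) * r powr \<delta>)"
    by (simp add: ennreal_mult' ennreal_of_nat_eq_real_of_nat n_def)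
  finally show ?thesis .
qed

lemma power_powr_commute: "x > 0 \<Longrightarrow> (x ^ n) powr a = (x powr a) ^ n" for x a :: real
  by (induction n) (simp_all add: powr_mult)

text \<open>The hypothesis says that \<open>M < b\<close> with \<open>b = d powr \<delta>\<close>;
  after division by \<open>b ^ L\<close>, a linear factor in \<open>L\<close> meets the geometric
  decay of \<open>(M / b) ^ L\<close>.\<close>

lemma exists_word_length:
  fixes d M :: nat and \<delta> :: real
  assumes d: "d > 1" and M: "1 \<le> M" and \<delta>: "ln (real M) / ln (real d) < \<delta>"
  obtains L where "real ((1 + d) * (L + 1) * M ^ L + 1) < (real d ^ L) powr \<delta>"
proof -
  define b where "b = real d powr \<delta>"
  define q where "q = real M / b"
  have "ln (real M) < \<delta> * ln (real d)" using \<delta> d by (simp add: field_simps)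
  then have "exp (ln (real M)) < exp (\<delta> * ln (real d))" by simp
  then have Mb: "real M < b" using d M by (simp add: b_def powr_def)
  have q: "0 \<le> q" "q < 1" "0 < b" using Mb M by (auto simp: q_def field_simps)
  have 1: "(\<lambda>L. real L * q ^ L) \<longlonglongrightarrow> 0" using q by (intro powser_times_n_limit_0) auto
  have 2: "(\<lambda>L. q ^ L) \<longlonglongrightarrow> 0" using q by (intro LIMSEQ_power_zero) auto
  have "(\<lambda>L. real (1 + d) * (real L * q ^ L) + (real (1 + d) + 1) * q ^ L)
      \<longlonglongrightarrow> real (1 + d) * 0 + (real (1 + d) + 1) * 0"
    by (intro tendsto_intros 1 2)
  then have "\<forall>\<^sub>F L in sequentially. real (1 + d) * (real L * q ^ L) + (real (1 + d) + 1) * q ^ L < 1"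
    by (rule order_tendstoD) simp
  then obtain L where L: "real (1 + d) * (real L * q ^ L) + (real (1 + d) + 1) * q ^ L < 1"
    by (auto simp: eventually_sequentially)
  have qM: "q ^ L * b ^ L = real M ^ L" using q by (simp add: q_def power_divide)
  have "real ((1 + d) * (L + 1) * M ^ L + 1) \<le> real ((1 + d) * (L + 1) * M ^ L) + real (M ^ L)"
    using M by (simp del: of_nat_power)
  also have "\<dots> = (real (1 + d) * (real L * q ^ L) + (real (1 + d) + 1) * q ^ L) * b ^ L"
    by (simp add: qM[symmetric] algebra_simps)
  also have "\<dots> < 1 * b ^ L" using L q by (intro mult_strict_right_mono) auto
  also have "\<dots> = (real d ^ L) powr \<delta>"
    using d by (simp add: b_def power_powr_commute)
  finally show ?thesis by (rule that)
qed

text \<open>At scale \<open>D ^ -p\<close> each word set needs at most \<open>B ^ p\<close> balls,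
  and the number of word sets does not depend on \<open>p\<close>. As
  \<open>B < D powr \<delta>\<close>, the total content tends to \<open>0\<close>.\<close>

lemma hausdorff_content_low_degree_points:
  assumes d: "d > 1" and M: "1 \<le> M" and \<delta>: "ln (real M) / ln (real d) < \<delta>"
  shows "hausdorff_content \<delta> (closure (low_degree_points M d)) = 0"
proof -
  obtain L where L: "real ((1 + d) * (L + 1) * M ^ L + 1) < (real d ^ L) powr \<delta>"
    using exists_word_length[OF assms] .
  define B where "B = (1 + d) * (L + 1) * M ^ L + 1"
  define D where "D = real d ^ L"
  \<comment> \<open>All candidate word sets: words of length \<open>L\<close> are integers below
    \<open>d ^ L\<close>, so there are finitely many candidates although there may be infinitely
    many cycles.\<close>
  define \<W> where "\<W> = {W \<in> Pow {0..<int d ^ L}. card W \<le> B}"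
  define S where "S p = (\<Union>W\<in>\<W>. base_words W (int d ^ L) p)" for p
  have D0: "D > 0" using d by (simp add: D_def)
  have fin\<W>: "finite \<W>" and finW: "W \<in> \<W> \<Longrightarrow> finite W" for W
    by (auto simp: \<W>_def intro: finite_subset)
  have fin: "finite (S p)" for p
    unfolding S_def using fin\<W> finW by (auto intro: finite_base_words)
  have card: "card (S p) \<le> card \<W> * B ^ p" for p
  proof -
    have "card (S p) \<le> (\<Sum>W\<in>\<W>. card (base_words W (int d ^ L) p))"
      unfolding S_def by (rule card_UN_le[OF fin\<W>])
    also have "\<dots> \<le> (\<Sum>W\<in>\<W>. B ^ p)"
      using finW by (intro sum_mono order.trans[OF card_base_words_le power_mono]) (auto simp: \<W>_def)
    finally show ?thesis by simp
  qed
  have cover: "low_degree_points M d \<subseteq> (\<Union>j\<in>S p. cball (circle_proj (of_int j / D ^ p)) (1 / D ^ p))" for p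
  proof
    fix c assume "c \<in> low_degree_points M d"
    then obtain C m f where C: "cycle d C" "c \<in> C" "m \<le> M" "degree_map m f" "\<forall>x\<in>C. f x = dmap d x"
      unfolding low_degree_points_def by auto
    obtain x0 where x0: "c = circle_proj x0" by (rule circle_proj_surj)
    define x where "x = frac x0"
    have "circle_proj x = c" unfolding x0 circle_proj_eq_iff x_def by (simp add: frac_def)
    then have x: "x \<in> unit_lift C" using C by (simp add: x_def unit_lift_def frac_ge_0 frac_lt_1)
    define W where "W = (\<lambda>x. \<lfloor>real d ^ L * x\<rfloor>) ` unit_lift C"
    have "card W \<le> B"
      unfolding W_def B_def by (rule card_words_le[OF C(1,4) _ C(3) M]) (use C(5) in auto)
    moreover have "W \<subseteq> {0..<int d ^ L}"
    proof
      fix w assume "w \<in> W"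
      then obtain y where y: "0 \<le> y" "y < 1" "w = \<lfloor>D * y\<rfloor>"
        by (auto simp: W_def unit_lift_def D_def)
      then have "0 \<le> D * y" "D * y < D" using D0 by auto
      then show "w \<in> {0..<int d ^ L}" using y(3) by (simp add: D_def floor_less_iff)
    qed
    ultimately have "W \<in> \<W>" by (simp add: \<W>_def)
    moreover have "\<lfloor>D ^ p * x\<rfloor> \<in> base_words W (int d ^ L) p"
      unfolding W_def D_def
      by (rule floor_in_base_words[OF _ x]) (use C(1) in \<open>auto simp: cycle_def bij_betw_def\<close>)
    ultimately have j: "\<lfloor>D ^ p * x\<rfloor> \<in> S p" by (auto simp: S_def)
    have "D ^ p > 0" using D0 by simp
    define k where "k = \<lfloor>D ^ p * x\<rfloor>"
    have "\<bar>of_int k - D ^ p * x\<bar> \<le> 1" unfolding k_def by linarith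
    moreover have e: "of_int k / D ^ p - x = (of_int k - D ^ p * x) / D ^ p"
      using D0 by (simp add: diff_divide_distrib)
    ultimately have "\<bar>of_int k / D ^ p - x\<bar> \<le> 1 / D ^ p"
      using \<open>D ^ p > 0\<close> unfolding e abs_divide by (simp add: divide_right_mono)
    then have "infdist (of_int k / D ^ p - x) \<int> \<le> 1 / D ^ p"
      using infdist_Ints_le[OF Ints_0, of "of_int k / D ^ p - x"]
      unfolding diff_zero by (rule order.trans[rotated])
    then have "dist (circle_proj (of_int k / D ^ p)) c \<le> 1 / D ^ p"
      by (simp only: \<open>circle_proj x = c\<close>[symmetric] dist_circle_proj)
    then show "c \<in> (\<Union>j\<in>S p. cball (circle_proj (of_int j / D ^ p)) (1 / D ^ p))"
      using j by (intro UN_I[of k]) (simp_all add: k_def)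
  qed
  have bound: "hausdorff_content \<delta> (closure (low_degree_points M d))
      \<le> ennreal (real (card \<W>) * 2 powr \<delta> * (real B / D powr \<delta>) ^ p)" for p
  proof -
    \<comment> \<open>A finite union of closed balls is closed and so captures the closure; doubling
      the radius then returns to open balls.\<close>
    have "closure (low_degree_points M d) \<subseteq> (\<Union>j\<in>S p. cball (circle_proj (of_int j / D ^ p)) (1 / D ^ p))"
      by (intro closure_minimal cover closed_UN fin) auto
    also have "\<dots> \<subseteq> (\<Union>j\<in>S p. ball (circle_proj (of_int j / D ^ p)) (2 / D ^ p))"
    proof -
      have "1 / D ^ p < 2 / D ^ p" using D0 by (simp add: divide_strict_right_mono)
      then show ?thesis by (intro UN_mono) auto
    qed
    finally have "hausdorff_content \<delta> (closure (low_degree_points M d))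
        \<le> ennreal (real (card (S p)) * (2 / D ^ p) powr \<delta>)"
      using D0 by (intro hausdorff_content_le_finite fin) auto
    also have "\<dots> \<le> ennreal (real (card \<W> * B ^ p) * (2 / D ^ p) powr \<delta>)"
      using card[of p] by (intro ennreal_leI mult_right_mono) (auto simp del: of_nat_mult)
    also have "(2 / D ^ p) powr \<delta> = 2 powr \<delta> / (D powr \<delta>) ^ p"
      using D0 by (simp add: powr_divide power_powr_commute)
    finally show ?thesis by (simp add: power_divide mult_ac)
  qed
  have q: "0 \<le> real B / D powr \<delta>" "real B / D powr \<delta> < 1"
    using L D0 by (auto simp: B_def D_def)
  have "(\<lambda>p. ennreal (real (card \<W>) * 2 powr \<delta> * (real B / D powr \<delta>) ^ p))
      \<longlonglongrightarrow> ennreal (real (card \<W>) * 2 powr \<delta> * 0)"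
    using q by (intro tendsto_ennrealI tendsto_intros LIMSEQ_power_zero) auto
  then have "hausdorff_content \<delta> (closure (low_degree_points M d)) \<le> ennreal (real (card \<W>) * 2 powr \<delta> * 0)"
    using bound by (intro LIMSEQ_le_const) auto
  then show ?thesis by simp
qed

section \<open>Rewriting base m expansions in base d\<close>

text \<open>
  For \<open>0 \<le> t < 1\<close>, this turns the base \<open>m\<close> expansion \<open>t = (\<Sum>n. a n / m ^ (n + 1))\<close> into
  \<open>(\<Sum>n. a n / d ^ (n + 1))\<close>. For \<open>m < d\<close> it equals
  \<open>(d - m) * (\<Sum>n. \<lfloor>m ^ n * t\<rfloor> / d ^ (n + 1))\<close>, which solves the functional equation
  \<open>change_base_mult\<close>; writing it with fractional parts also covers \<open>m = d\<close>.
\<close>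

definition change_base :: "nat \<Rightarrow> nat \<Rightarrow> real \<Rightarrow> real" where
  "change_base m d t = t - (real d - real m) * (\<Sum>n. frac (real m ^ n * t) / real d ^ Suc n)"

lemma summable_change_base:
  assumes "d > 1"
  shows "summable (\<lambda>n. frac (real m ^ n * t) / real d ^ Suc n)"
proof (rule summable_comparison_test')
  show "summable (\<lambda>n. (1 / real d) ^ n)" using assms by (intro summable_geometric) simp
  show "norm (frac (real m ^ n * t) / real d ^ Suc n) \<le> (1 / real d) ^ n" if "n \<ge> 0" for n
  proof -
    have "frac (real m ^ n * t) / real d ^ Suc n \<le> 1 / real d ^ n"
      using assms by (intro frac_le) (auto simp: frac_ge_0 less_imp_le[OF frac_lt_1])
    moreover have "0 \<le> frac (real m ^ n * t) / real d ^ Suc n"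
      by (simp add: frac_ge_0)
    ultimately show ?thesis by (simp add: power_divide)
  qed
qed

lemma change_base_bounds:
  assumes "d > 1" "1 \<le> m" "m \<le> d"
  shows "t - 1 \<le> change_base m d t" "change_base m d t \<le> t"
proof -
  let ?S = "\<Sum>n. frac (real m ^ n * t) / real d ^ Suc n"
  have "(\<lambda>n. 1 / real d * (1 / real d) ^ n) sums (1 / real d * (1 / (1 - 1 / real d)))"
    using assms by (intro sums_mult geometric_sums) simp
  then have sums: "(\<lambda>n. 1 / real d ^ Suc n) sums (1 / (real d - 1))"
    using assms by (simp add: power_divide field_simps)
  have S0: "0 \<le> ?S"
    using assms by (intro suminf_nonneg summable_change_base) (simp_all add: frac_ge_0)
  have "?S \<le> (\<Sum>n. 1 / real d ^ Suc n)"
    using assms by (intro suminf_le summable_change_base sums_summable[OF sums] divide_right_mono)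
      (auto simp: less_imp_le[OF frac_lt_1])
  then have "?S \<le> 1 / (real d - 1)" using sums_unique[OF sums] by simp
  then have "(real d - real m) * ?S \<le> (real d - 1) * (1 / (real d - 1))"
    using assms S0 by (intro mult_mono) auto
  then show "t - 1 \<le> change_base m d t" using assms by (simp add: change_base_def)
  show "change_base m d t \<le> t" using S0 assms by (simp add: change_base_def)
qed

text \<open>The tail of the series at \<open>t\<close> is the series at \<open>m * t\<close> divided
  by \<open>d\<close>. The floor term is an integer, so modulo 1 this turns multiplication by
  \<open>m\<close> into the \<open>d\<close>-map.\<close>

lemma change_base_mult:
  assumes "d > 1"
  shows "real d * change_base m d t = (real d - real m) * of_int \<lfloor>t\<rfloor> + change_base m d (real m * t)"
proof -
  let ?f = "\<lambda>t n. frac (real m ^ n * t) / real d ^ Suc n"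
  have "?f t (Suc n) = ?f (real m * t) n / real d" for n by (simp add: mult_ac)
  then have "(\<Sum>n. ?f t (Suc n)) = (\<Sum>n. ?f (real m * t) n) / real d"
    using suminf_divide[OF summable_change_base[OF assms]] by presburger
  moreover have "(\<Sum>n. ?f t (Suc n)) = (\<Sum>n. ?f t n) - ?f t 0"
    by (rule suminf_split_head[OF summable_change_base[OF assms]])
  ultimately have "(\<Sum>n. ?f t n) = frac t / real d + (\<Sum>n. ?f (real m * t) n) / real d"
    by simp
  then have S: "real d * (\<Sum>n. ?f t n) = frac t + (\<Sum>n. ?f (real m * t) n)"
    using assms by (simp add: field_simps)
  have "real d * change_base m d t = real d * t - (real d - real m) * (real d * (\<Sum>n. ?f t n))"
    unfolding change_base_def by (simp add: algebra_simps)
  then show ?thesis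
    unfolding S by (simp add: change_base_def frac_def algebra_simps)
qed

lemma change_base_add_int: "change_base m d (t + of_int k) = change_base m d t + of_int k"
proof -
  have "frac (real m ^ n * (t + of_int k)) = frac (real m ^ n * t)" for n
  proof -
    have "real m ^ n * (t + of_int k) = real m ^ n * t + of_int (int m ^ n * k)"
      by (simp add: algebra_simps)
    then show ?thesis by (simp only: frac_def floor_add_int[symmetric] of_int_add)
  qed
  then show ?thesis by (simp add: change_base_def)
qed

lemma change_base_of_int: "change_base m d (of_int k) = of_int k"
  using change_base_add_int[of m d 0 k] by (simp add: change_base_def)

text \<open>Iteration of \<open>change_base_mult\<close>: for \<open>t \<le> t'\<close> the floor
  terms dropped on the way have a nonnegative difference.\<close>

lemma change_base_expand:
  assumes "d > 1" "m \<le> d" "t \<le> t'"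
  shows "change_base m d (real m ^ n * t') - change_base m d (real m ^ n * t)
    \<le> real d ^ n * (change_base m d t' - change_base m d t)"
  using assms(3)
proof (induction n arbitrary: t t')
  case (Suc n)
  have "real m * t \<le> real m * t'" using Suc.prems by (simp add: mult_left_mono)
  from Suc.IH[OF this]
  have "change_base m d (real m ^ Suc n * t') - change_base m d (real m ^ Suc n * t)
      \<le> real d ^ n * (change_base m d (real m * t') - change_base m d (real m * t))"
    by (simp add: mult_ac)
  also have "\<dots> \<le> real d ^ n * (real d * (change_base m d t' - change_base m d t))"
  proof (rule mult_left_mono)
    have "of_int \<lfloor>t\<rfloor> \<le> (of_int \<lfloor>t'\<rfloor> :: real)" using Suc.prems by (simp add: floor_mono)
    then have "(real d - real m) * of_int \<lfloor>t\<rfloor> \<le> (real d - real m) * of_int \<lfloor>t'\<rfloor>"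
      using assms(2) by (intro mult_left_mono) auto
    then show "change_base m d (real m * t') - change_base m d (real m * t)
        \<le> real d * (change_base m d t' - change_base m d t)"
      using change_base_mult[OF assms(1), of m t] change_base_mult[OF assms(1), of m t']
      by (simp add: right_diff_distrib)
  qed simp
  finally show ?case by (simp add: mult_ac)
qed simp

text \<open>After scaling by \<open>m ^ n\<close>, the bounds \<open>change_base_bounds\<close>
  limit any decrease to 1; \<open>change_base_expand\<close> shrinks this to
  \<open>1 / d ^ n\<close>, and \<open>n\<close> is arbitrary.\<close>

lemma change_base_mono:
  assumes "d > 1" "1 \<le> m" "m \<le> d" "t \<le> t'"
  shows "change_base m d t \<le> change_base m d t'"
proof -
  have "-1 / real d ^ n \<le> change_base m d t' - change_base m d t" for n
  proof -
    have "-1 \<le> change_base m d (real m ^ n * t') - change_base m d (real m ^ n * t)"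
      using change_base_bounds(1)[OF assms(1-3), of "real m ^ n * t'"]
        change_base_bounds(2)[OF assms(1-3), of "real m ^ n * t"]
        mult_left_mono[OF assms(4), of "real m ^ n"] by simp
    also note change_base_expand[OF assms(1,3,4)]
    finally show ?thesis using assms(1) by (simp add: field_simps)
  qed
  moreover have "(\<lambda>n. -1 / real d ^ n) \<longlonglongrightarrow> 0"
    using tendsto_minus[OF LIMSEQ_power_zero[of "1 / real d"]] assms(1) by (simp add: power_divide)
  ultimately have "0 \<le> change_base m d t' - change_base m d t" by (intro LIMSEQ_le_const2) auto
  then show ?thesis by simp
qed

text \<open>Arguments at least 1 apart have values at least 1 apart, by monotonicity and
  equivariance under integers; \<open>change_base_expand\<close> carries this from scale
  \<open>m ^ -n\<close> to scale \<open>d ^ -n\<close>.\<close>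

lemma change_base_gap:
  assumes "d > 1" "1 \<le> m" "m \<le> d" "t \<le> t'" "1 \<le> real m ^ n * (t' - t)"
  shows "1 \<le> real d ^ n * (change_base m d t' - change_base m d t)"
proof -
  have "change_base m d (real m ^ n * t) + 1 = change_base m d (real m ^ n * t + of_int 1)"
    using change_base_add_int[of m d "real m ^ n * t" 1] by simp
  also have "\<dots> \<le> change_base m d (real m ^ n * t')"
    using assms(5) by (intro change_base_mono assms(1-3)) (simp add: algebra_simps)
  finally show ?thesis using change_base_expand[OF assms(1,3,4), of n] by simp
qed

lemma change_base_between:
  assumes "d > 1" "1 \<le> m" "m \<le> d"
  shows "of_int \<lfloor>t\<rfloor> \<le> change_base m d t" "change_base m d t \<le> of_int \<lfloor>t\<rfloor> + 1"
proof -
  show "of_int \<lfloor>t\<rfloor> \<le> change_base m d t"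
    using change_base_mono[OF assms of_int_floor_le[of t]] by (simp add: change_base_of_int)
  have "t \<le> of_int (\<lfloor>t\<rfloor> + 1)" by linarith
  from change_base_mono[OF assms this]
  show "change_base m d t \<le> of_int \<lfloor>t\<rfloor> + 1" unfolding change_base_of_int by simp
qed

text \<open>While the integer parts agree, the floor terms of \<open>change_base_mult\<close> cancel
  and each common digit gains a factor \<open>d\<close>. This makes periodic approximations
  converge.\<close>

lemma change_base_close:
  assumes "d > 1" "1 \<le> m" "m \<le> d" "\<lfloor>real m ^ n * t\<rfloor> = \<lfloor>real m ^ n * t'\<rfloor>"
  shows "\<bar>change_base m d t - change_base m d t'\<bar> \<le> 1 / real d ^ n"
  using assms(4)
proof (induction n arbitrary: t t')
  case 0
  then show ?case
    using change_base_between[OF assms(1-3), of t] change_base_between[OF assms(1-3), of t'] by simp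
next
  case (Suc n)
  \<comment> \<open>The leading digits fix the integer part, so the hypothesis at level
    \<open>Suc n\<close> also gives equal floors of \<open>t\<close> and \<open>t'\<close>.\<close>
  have f: "\<lfloor>u\<rfloor> = \<lfloor>real m ^ Suc n * u\<rfloor> div int m ^ Suc n" for u
    using floor_divide_real_eq_div[of "int m ^ Suc n" "real m ^ Suc n * u"] assms(2) by simp
  have "\<lfloor>t\<rfloor> = \<lfloor>t'\<rfloor>" unfolding f[of t] f[of t'] Suc.prems ..
  then have "real d * (change_base m d t - change_base m d t')
      = change_base m d (real m * t) - change_base m d (real m * t')"
    using change_base_mult[OF assms(1), of m t] change_base_mult[OF assms(1), of m t']
    by (simp add: right_diff_distrib)
  moreover have "\<bar>change_base m d (real m * t) - change_base m d (real m * t')\<bar> \<le> 1 / real d ^ n"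
    using Suc.prems by (intro Suc.IH) (simp add: mult_ac)
  ultimately have "real d * \<bar>change_base m d t - change_base m d t'\<bar> \<le> 1 / real d ^ n"
    by (metis abs_mult abs_of_nat)
  then show ?case using assms(1) by (simp add: field_simps)
qed

text \<open>Take the least \<open>k\<close> with \<open>m ^ k * (t' - t) \<ge> 1\<close>. Minimality
  gives \<open>t' - t \<le> m / m ^ k\<close>, \<open>change_base_gap\<close> gives
  \<open>d ^ k * \<rho> \<ge> 1\<close>, and \<open>d powr \<delta> \<le> m\<close> converts one
  scale into the other.\<close>

lemma change_base_holder:
  assumes d: "d > 1" and m: "2 \<le> m" "m \<le> d" and \<delta>: "0 \<le> \<delta>" "\<delta> \<le> ln (real m) / ln (real d)"
    and t: "t \<le> t'" "t' - t \<le> 1" and \<rho>: "change_base m d t' - change_base m d t < \<rho>" "0 < \<rho>"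
  shows "t' - t \<le> real m * \<rho> powr \<delta>"
proof (cases "t = t'")
  case False
  then have pos: "t' - t > 0" using t by simp
  have m1: "1 \<le> m" using m by simp
  obtain k0 where "1 / (t' - t) < real m ^ k0" using real_arch_pow[of "real m"] m by auto
  then have ex: "1 \<le> real m ^ k0 * (t' - t)" using pos by (simp add: field_simps)
  define k where "k = (LEAST k. 1 \<le> real m ^ k * (t' - t))"
  have k: "1 \<le> real m ^ k * (t' - t)" unfolding k_def by (rule LeastI[where k = k0]) (rule ex)
  have "real m ^ k * (t' - t) \<le> real m"
  proof (cases k)
    case 0
    then show ?thesis using t m by simp
  next
    case (Suc j)
    then have "\<not> 1 \<le> real m ^ j * (t' - t)" 
      using not_less_Least[of j "\<lambda>k. 1 \<le> real m ^ k * (t' - t)"] unfolding k_def by linarith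
    then have "real m * (real m ^ j * (t' - t)) \<le> real m * 1" by (intro mult_left_mono) auto
    then show ?thesis using Suc by (simp add: mult_ac)
  qed
  then have le: "t' - t \<le> real m * (1 / real m ^ k)" using m by (simp add: field_simps)
  have "1 \<le> real d ^ k * (change_base m d t' - change_base m d t)"
    by (rule change_base_gap[OF d m1 m(2) t(1) k])
  also have "\<dots> \<le> real d ^ k * \<rho>" using \<rho> by (intro mult_left_mono) auto
  finally have \<rho>k: "1 \<le> real d ^ k * \<rho>" .
  have "real d powr \<delta> \<le> real d powr (ln (real m) / ln (real d))"
    using d \<delta> by (intro powr_mono) auto
  also have "\<dots> = real m" using d m by (simp add: powr_def)
  finally have "(real d powr \<delta>) ^ k * \<rho> powr \<delta> \<le> real m ^ k * \<rho> powr \<delta>"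
    by (intro mult_right_mono power_mono) auto
  moreover have "1 \<le> (real d ^ k * \<rho>) powr \<delta>" using \<rho>k \<delta> by (simp add: ge_one_powr_ge_zero)
  moreover have "(real d ^ k * \<rho>) powr \<delta> = (real d powr \<delta>) ^ k * \<rho> powr \<delta>"
    using d \<rho> by (simp add: powr_mult power_powr_commute)
  ultimately have "1 \<le> real m ^ k * \<rho> powr \<delta>" by linarith
  then have "1 / real m ^ k \<le> \<rho> powr \<delta>" using m by (simp add: field_simps)
  then show ?thesis using le m mult_left_mono[of "1 / real m ^ k" "\<rho> powr \<delta>" "real m"] by linarith
qed (use m in simp)

section \<open>Periodic expansions give cycles of low degree\<close>

lemma cycle_orbit:
  assumes "N > 0" "(dmap d ^^ N) c = c"
  shows "cycle d (range (\<lambda>i. (dmap d ^^ i) c))" (is "cycle d ?C")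
proof -
  have period: "(dmap d ^^ (i mod N)) c = (dmap d ^^ i) c" for i
    by (rule funpow_mod_eq[OF assms(2)])
  have "?C \<subseteq> (\<lambda>i. (dmap d ^^ i) c) ` {..<N}"
  proof
    fix y assume "y \<in> ?C"
    then obtain i where "y = (dmap d ^^ (i mod N)) c" using period by auto
    then show "y \<in> (\<lambda>i. (dmap d ^^ i) c) ` {..<N}" using assms(1) by auto
  qed
  then have fin: "finite ?C" by (rule finite_subset) simp
  have reach: "\<exists>k. (dmap d ^^ k) ((dmap d ^^ i) c) = (dmap d ^^ j) c" for i j
  proof (intro exI)
    \<comment> \<open>Adding \<open>i\<close> full periods to the target time \<open>j\<close> makes
      it reachable from time \<open>i\<close> going forward.\<close>
    have "i \<le> j + N * i" using assms(1) by (simp add: trans_le_add2)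
    then have "(dmap d ^^ (j + N * i - i)) ((dmap d ^^ i) c) = (dmap d ^^ (j + N * i)) c"
      by (metis comp_apply funpow_add le_add_diff_inverse2)
    also have "\<dots> = (dmap d ^^ j) c"
      using period[of "j + N * i"] period[of j] by simp
    finally show "(dmap d ^^ (j + N * i - i)) ((dmap d ^^ i) c) = (dmap d ^^ j) c" .
  qed
  have "dmap d ` ?C = ?C"
  proof
    show "dmap d ` ?C \<subseteq> ?C"
    proof
      fix y assume "y \<in> dmap d ` ?C"
      then obtain i where "y = (dmap d ^^ Suc i) c" by auto
      then show "y \<in> ?C" by blast
    qed
    show "?C \<subseteq> dmap d ` ?C"
    proof
      fix y assume "y \<in> ?C"
      then obtain i where "y = (dmap d ^^ i) c" by auto
      also have "\<dots> = (dmap d ^^ (i + N)) c" by (simp add: funpow_add assms(2))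
      also have "\<dots> = dmap d ((dmap d ^^ (i + (N - 1))) c)"
        using assms(1) by (cases N) auto
      finally show "y \<in> dmap d ` ?C" by blast
    qed
  qed
  then have "bij_betw (dmap d) ?C ?C" using fin by (simp add: bij_betw_def eq_card_imp_inj_on)
  then show ?thesis unfolding cycle_def using fin reach by fastforce
qed

text \<open>The degree \<open>m\<close> map that follows the \<open>d\<close>-map on \<open>[0, m/d]\<close> and is constant on \<open>[m/d, 1]\<close>.\<close>

definition collapse_lift :: "nat \<Rightarrow> nat \<Rightarrow> real \<Rightarrow> real" where
  "collapse_lift m d x = real m * of_int \<lfloor>x\<rfloor> + min (real d * frac x) (real m)"

lemma collapse_lift_increment:
  assumes "m \<le> d" "x \<le> y"
  shows "collapse_lift m d x \<le> collapse_lift m d y"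
    "collapse_lift m d y - collapse_lift m d x \<le> real d * (y - x)"
proof -
  define n k u v where "n = (of_int \<lfloor>x\<rfloor> :: real)" and "k = (of_int \<lfloor>y\<rfloor> :: real)"
    and "u = frac x" and "v = frac y"
  have xy: "x = n + u" "y = k + v" and uv: "0 \<le> u" "u < 1" "0 \<le> v" "v < 1"
    by (auto simp: n_def k_def u_def v_def frac_def) linarith+
  have du: "0 \<le> real d * u" "real d * u \<le> real d" "0 \<le> real d * v"
    using uv by (auto simp: mult_left_le)
  have F: "collapse_lift m d x = real m * n + min (real d * u) (real m)"
    "collapse_lift m d y = real m * k + min (real d * v) (real m)"
    by (simp_all add: collapse_lift_def n_def k_def u_def v_def)
  consider "n = k" | "n + 1 \<le> k"
  proof -
    have "\<lfloor>x\<rfloor> \<le> \<lfloor>y\<rfloor>" using assms(2) by (rule floor_mono)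
    then have "\<lfloor>x\<rfloor> = \<lfloor>y\<rfloor> \<or> \<lfloor>x\<rfloor> + 1 \<le> \<lfloor>y\<rfloor>" by linarith
    then show thesis using that unfolding n_def k_def by linarith
  qed
  then have "collapse_lift m d x \<le> collapse_lift m d y \<and>
    collapse_lift m d y - collapse_lift m d x \<le> real d * (y - x)"
  proof cases
    case 1
    then have "u \<le> v" using assms(2) xy by simp
    then have "real d * u \<le> real d * v" by (simp add: mult_left_mono)
    then show ?thesis unfolding F using 1 xy by (auto simp: algebra_simps)
  next
    case 2
    have a: "real m * 1 \<le> real m * (k - n)" using 2 by (intro mult_left_mono) auto
    \<comment> \<open>For the Lipschitz bound, \<open>b\<close> serves the case of \<open>x\<close>
      on the sloped part, \<open>c\<close> that of \<open>x\<close> on the plateau.\<close>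
    have b: "real m * (k - n) \<le> real d * (k - n)" using 2 assms(1) by (intro mult_right_mono) auto
    have c: "real m * (k - n - 1) \<le> real d * (k - n - 1)" using 2 assms(1) by (intro mult_right_mono) auto
    have "real m * n + real m \<le> real m * k" using a by (simp add: algebra_simps)
    moreover have "real m * k + real d * v - (real m * n + min (real d * u) (real m))
        \<le> real d * (k + v - (n + u))"
      using b c du by (auto simp: algebra_simps min_def)
    ultimately show ?thesis unfolding F using xy du by (auto simp: min_def)
  qed
  then show "collapse_lift m d x \<le> collapse_lift m d y"
    "collapse_lift m d y - collapse_lift m d x \<le> real d * (y - x)" by auto
qed

lemma collapse_lift_degree_map:
  assumes "m \<le> d"
  obtains f where "degree_map m f" "\<And>x. f (circle_proj x) = circle_proj (collapse_lift m d x)"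
proof -
  let ?F = "collapse_lift m d"
  have add_int: "?F (x + of_int k) = ?F x + of_int (int m * k)" for x k
    by (simp add: collapse_lift_def frac_def algebra_simps)
  \<comment> \<open>The choice of representative is immaterial: integer shifts of the argument
    change \<open>?F\<close> by integers.\<close>
  define f where "f c = circle_proj (?F (SOME x. c = circle_proj x))" for c
  have f: "f (circle_proj x) = circle_proj (?F x)" for x
  proof -
    define y where "y = (SOME y. circle_proj x = circle_proj y)"
    have "circle_proj x = circle_proj y" unfolding y_def by (rule someI[of _ x]) simp
    then obtain k where "y - x = of_int k" by (metis circle_proj_eq_iff Ints_cases)
    then have "?F y = ?F x + of_int (int m * k)" using add_int[of x k] by (simp add: algebra_simps)
    then have "?F y - ?F x \<in> \<int>" by simp
    then have "circle_proj (?F y) = circle_proj (?F x)" by (simp only: circle_proj_eq_iff)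
    then show ?thesis unfolding f_def y_def .
  qed
  have "continuous_on UNIV ?F"
  proof (rule lipschitz_on_continuous_on[OF lipschitz_onI])
    show "dist (?F x) (?F y) \<le> real d * dist x y" for x y
      using collapse_lift_increment[OF assms, of x y] collapse_lift_increment[OF assms, of y x]
      by (cases "x \<le> y") (auto simp: dist_real_def)
  qed simp
  moreover have "mono ?F" using collapse_lift_increment(1)[OF assms] by (intro monoI)
  moreover have "?F (x + 1) = ?F x + real m" for x using add_int[of x 1] by simp
  ultimately have "degree_map m f" using f unfolding degree_map_def by blast
  then show ?thesis using f by (rule that)
qed

text \<open>For \<open>t\<close> in \<open>[n, n + 1)\<close>, the value at \<open>t\<close> lies in
  \<open>[n, n + m/d]\<close>, where the collapse lift is still multiplication by \<open>d\<close>
  up to an integer; there it coincides with the functional equation.\<close>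

lemma collapse_lift_change_base:
  assumes "d > 1" "1 \<le> m" "m \<le> d"
  shows "collapse_lift m d (change_base m d t) = change_base m d (real m * t)"
proof -
  define x n where "x = change_base m d t" and "n = \<lfloor>t\<rfloor>"
  have eq: "change_base m d (real m * t) = real m * of_int n + real d * (x - of_int n)"
    using change_base_mult[OF assms(1), of m t] by (simp add: x_def n_def algebra_simps)
  have "real m * t \<le> real m * (of_int n + 1)" using assms unfolding n_def
    by (intro mult_left_mono) linarith+
  then have "real m * t \<le> of_int (int m * (n + 1))" by simp
  from change_base_mono[OF assms this]
  have "change_base m d (real m * t) \<le> of_int (int m * (n + 1))" unfolding change_base_of_int .
  then have le: "real d * (x - of_int n) \<le> real m" unfolding eq by (simp add: algebra_simps)
  have b: "of_int n \<le> x" "x \<le> of_int n + 1"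
    using change_base_between[OF assms, of t] by (simp_all add: x_def n_def)
  show ?thesis
  proof (cases "x = of_int n + 1")
    \<comment> \<open>The floor of \<open>x\<close> would be \<open>n + 1\<close> instead of
      \<open>n\<close>; but then \<open>m = d\<close>, and both formulas agree.\<close>
    case True
    then have "m = d" using le assms by simp
    then show ?thesis unfolding eq x_def[symmetric]
      using True by (simp add: collapse_lift_def algebra_simps)
  next
    case False
    then have "\<lfloor>x\<rfloor> = n" using b by (intro floor_unique) auto
    then show ?thesis unfolding eq x_def[symmetric]
      using le by (simp add: collapse_lift_def frac_def)
  qed
qed

text \<open>\<open>change_base\<close> sends the periodic orbit of \<open>t\<close> under
  multiplication by \<open>m\<close> to a periodic orbit of the \<open>d\<close>-map, and on its
  whole image the collapse map of degree \<open>m\<close> agrees with the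
  \<open>d\<close>-map.\<close>

lemma periodic_in_low_degree_points:
  assumes "d > 1" "1 \<le> m" "m \<le> d" and N: "N > 0" and t: "real m ^ N * t - t \<in> \<int>"
  shows "circle_proj (change_base m d t) \<in> low_degree_points m d"
proof -
  obtain f where f: "degree_map m f" "\<And>x. f (circle_proj x) = circle_proj (collapse_lift m d x)"
    using collapse_lift_degree_map[OF assms(3)] by metis
  let ?p = "\<lambda>t. circle_proj (change_base m d t)"
  have step: "dmap d (?p t) = ?p (real m * t)" for t
  proof -
    have "real d * change_base m d t - change_base m d (real m * t) = of_int ((int d - int m) * \<lfloor>t\<rfloor>)"
      using change_base_mult[OF assms(1), of m t] by simp
    then show ?thesis unfolding dmap_proj circle_proj_eq_iff by (metis Ints_of_int)
  qed
  have iter: "(dmap d ^^ i) (?p t) = ?p (real m ^ i * t)" for i t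
    by (induction i) (simp_all add: step mult_ac)
  obtain k where k: "real m ^ N * t - t = of_int k" using t by (elim Ints_cases)
  then have "change_base m d (real m ^ N * t) = change_base m d t + of_int k"
    using change_base_add_int[of m d t k] by (simp add: algebra_simps)
  then have "?p (real m ^ N * t) = ?p t" unfolding circle_proj_eq_iff by simp
  then have "cycle d (range (\<lambda>i. (dmap d ^^ i) (?p t)))"
    by (intro cycle_orbit[OF N]) (simp add: iter)
  moreover have "?p t \<in> range (\<lambda>i. (dmap d ^^ i) (?p t))"
    by (rule range_eqI[of _ _ 0]) simp
  moreover have "\<forall>x \<in> range (\<lambda>i. (dmap d ^^ i) (?p t)). f x = dmap d x"
    by (auto simp: iter step f(2) collapse_lift_change_base[OF assms(1-3)])
  ultimately show ?thesis using f(1) unfolding low_degree_points_def by blast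
qed

text \<open>The point \<open>t\<close> is approximated by the number \<open>u\<close> that repeats
  its first \<open>n\<close> base \<open>m\<close> digits; \<open>change_base_close\<close> compares
  the images.\<close>

lemma change_base_in_closure:
  assumes d: "d > 1" and m: "2 \<le> m" "m \<le> d" and t: "0 \<le> t" "t < 1"
  shows "circle_proj (change_base m d t) \<in> closure (low_degree_points m d)"
  unfolding closure_approachable
proof (intro allI impI)
  fix e :: real assume "e > 0"
  have m1: "1 \<le> m" using m by simp
  obtain n1 where n1: "1 / e < real d ^ n1" using real_arch_pow[of "real d"] d by auto
  \<comment> \<open>This ensures that the first \<open>n\<close> digits of \<open>t\<close> are not
    all \<open>m - 1\<close>, so that \<open>u < 1\<close> below.\<close>
  obtain n2 where n2: "1 / (1 - t) < real m ^ n2" using real_arch_pow[of "real m"] m by auto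
  define n where "n = Suc (n1 + n2)"
  have "real d ^ n1 \<le> real d ^ n" "real m ^ n2 \<le> real m ^ n"
    using d m unfolding n_def by (intro power_increasing; simp)+
  then have "1 / e < real d ^ n" "1 / (1 - t) < real m ^ n" using n1 n2 by auto
  then have n: "1 / real d ^ n < e" "1 < real m ^ n * (1 - t)"
    using \<open>e > 0\<close> t d by (auto simp: field_simps)
  define p where "p = \<lfloor>real m ^ n * t\<rfloor>"
  \<comment> \<open>The purely periodic expansion with period block \<open>p\<close>: it solves
    \<open>m ^ n * u = p + u\<close>.\<close>
  define u where "u = of_int p / (real m ^ n - 1)"
  have "0 \<le> p" using t by (simp add: p_def)
  have "of_int p \<le> real m ^ n * t" by (simp add: p_def)
  then have p: "of_int p < real m ^ n - 1" using n by (simp add: algebra_simps)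
  then have pos: "real m ^ n - 1 > 0" using \<open>0 \<le> p\<close> by (smt (verit) of_int_nonneg)
  have u: "0 \<le> u" "u < 1" using p pos \<open>0 \<le> p\<close> by (auto simp: u_def)
  have "(real m ^ n - 1) * u = of_int p" using pos by (simp add: u_def)
  then have mu: "real m ^ n * u - u = of_int p" by (simp add: algebra_simps)
  then have "\<lfloor>real m ^ n * u\<rfloor> = p" using u by (intro floor_unique) auto
  then have "\<bar>change_base m d u - change_base m d t\<bar> \<le> 1 / real d ^ n"
    using change_base_close[OF d m1 m(2), of n u t] by (simp add: p_def)
  then have "dist (circle_proj (change_base m d u)) (circle_proj (change_base m d t)) < e"
    unfolding dist_circle_proj
    using infdist_Ints_le[OF Ints_0, of "change_base m d u - change_base m d t"] n(1) by linarith
  moreover have "circle_proj (change_base m d u) \<in> low_degree_points m d"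
  proof (rule periodic_in_low_degree_points[OF d m1 m(2)])
    show "n > 0" by (simp add: n_def)
    show "real m ^ n * u - u \<in> \<int>" unfolding mu by simp
  qed
  ultimately show "\<exists>y\<in>low_degree_points m d. dist y (circle_proj (change_base m d t)) < e" ..
qed

section \<open>Sets of small Hausdorff content\<close>

text \<open>Two points of the preimage have values less than \<open>2 * r\<close> apart, so
  \<open>change_base_holder\<close> confines it to an interval around any one of its points.\<close>

lemma change_base_preimage_ball:
  assumes d: "d > 1" and m: "2 \<le> m" "m \<le> d" and \<delta>: "0 \<le> \<delta>" "\<delta> \<le> ln (real m) / ln (real d)"
    and "0 < r"
  obtains a where "{t \<in> {0..<1}. \<bar>change_base m d t - c\<bar> < r}
    \<subseteq> {a - real m * (2 * r) powr \<delta> .. a + real m * (2 * r) powr \<delta>}"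
proof (cases "{t \<in> {0..<1}. \<bar>change_base m d t - c\<bar> < r} = {}")
  case False
  then obtain a where a: "0 \<le> a" "a < 1" "\<bar>change_base m d a - c\<bar> < r" by auto
  have "t' - t \<le> real m * (2 * r) powr \<delta>"
    if "0 \<le> t" "t \<le> t'" "t' < 1" "\<bar>change_base m d t - c\<bar> < r" "\<bar>change_base m d t' - c\<bar> < r" for t t'
    using that \<open>0 < r\<close> by (intro change_base_holder[OF d m \<delta>]) linarith+
  then have "{t \<in> {0..<1}. \<bar>change_base m d t - c\<bar> < r}
    \<subseteq> {a - real m * (2 * r) powr \<delta> .. a + real m * (2 * r) powr \<delta>}"
    using a by (smt (verit) atLeastAtMost_iff atLeastLessThan_iff mem_Collect_eq subsetI)
  then show ?thesis by (rule that)
next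
  case True
  show ?thesis by (rule that[of 0], subst True) (rule empty_subsetI)
qed

lemma circle_ball_lift:
  assumes "dist (circle_proj c) (circle_proj x) < r" "r \<le> 1 / 2" "0 \<le> c" "c < 1" "0 \<le> x" "x \<le> 1"
  shows "\<exists>n\<in>{-1, 0, 1 :: int}. \<bar>x - (c - of_int n)\<bar> < r"
proof -
  obtain n where n: "n \<in> \<int>" "infdist (c - x) \<int> = \<bar>c - x - n\<bar>" by (rule infdist_Ints_attained)
  then obtain k where k: "n = of_int k" by (elim Ints_cases)
  have less: "\<bar>c - x - of_int k\<bar> < r" using assms(1) n k by (simp add: dist_circle_proj)
  then have "- 2 < (of_int k :: real)" "of_int k < (2 :: real)" using assms by linarith+
  then have "k \<in> {-1, 0, 1}" by auto
  then show ?thesis using less by (intro bexI[of _ k]) (auto simp: abs_if split: if_splits)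
qed

text \<open>A cover of \<open>Z\<close> pulls back to intervals whose total length is at most a
  constant times the sum of the \<open>r i powr \<delta>\<close>, which can be made arbitrarily
  small.\<close>

lemma negligible_change_base_vimage:
  assumes d: "d > 1" and m: "2 \<le> m" "m \<le> d" and \<delta>: "0 \<le> \<delta>" "\<delta> \<le> ln (real m) / ln (real d)"
    and Z: "hausdorff_content \<delta> Z = 0"
  shows "negligible {t \<in> {0..<1}. circle_proj (change_base m d t) \<in> Z}"
  unfolding negligible_outer_le
proof (intro allI impI)
  fix e :: real assume "e > 0"
  have m1: "1 \<le> m" using m by simp
  \<comment> \<open>Three integer translates of each ball, each with preimage in an interval of
    length \<open>2 * m * (2 * r) powr \<delta>\<close>.\<close>
  define K where "K = 6 * real m * 2 powr \<delta>"
  have K: "K > 0" using m by (simp add: K_def)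
  \<comment> \<open>The second bound forces all radii to be at most \<open>1 / 2\<close>, as
    \<open>circle_ball_lift\<close> requires; for \<open>\<delta> = 0\<close> it leaves only the
    empty cover.\<close>
  define \<eta> where "\<eta> = min (e / K) ((1 / 2) powr \<delta>)"
  have \<eta>: "\<eta> > 0" using K \<open>e > 0\<close> by (simp add: \<eta>_def)
  have "hausdorff_content \<delta> Z < ennreal \<eta>" using Z \<eta> by simp
  then obtain I :: "nat set" and x r where
    less: "(\<Sum>\<^sub>\<infinity>i\<in>I. ennreal (r i powr \<delta>)) < ennreal \<eta>"
    and r: "\<And>i. i \<in> I \<Longrightarrow> r i > 0" and cover: "Z \<subseteq> (\<Union>i\<in>I. ball (x i) (r i))"
    unfolding hausdorff_content_def Inf_less_iff by auto
  \<comment> \<open>Extension by zero turns the sum over \<open>I\<close> into a series, to match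
    countable subadditivity.\<close>
  define f where "f i = (if i \<in> I then ennreal (r i powr \<delta>) else 0)" for i
  have "(\<Sum>\<^sub>\<infinity>i\<in>I. ennreal (r i powr \<delta>)) = (\<Sum>\<^sub>\<infinity>i. f i)"
    by (rule infsum_cong_neutral) (auto simp: f_def)
  also have "\<dots> = (\<Sum>i. f i)"
    by (intro sums_unique has_sum_imp_sums has_sum_infsum nonneg_summable_on_complete) simp
  finally have f_less: "(\<Sum>i. f i) < ennreal \<eta>" using less by simp
  have half: "r i \<le> 1 / 2" if "i \<in> I" for i
  proof (rule ccontr)
    assume "\<not> r i \<le> 1 / 2"
    then have "(1 / 2) powr \<delta> \<le> r i powr \<delta>" using \<delta> by (intro powr_mono2) auto
    then have "ennreal \<eta> \<le> ennreal (r i powr \<delta>)" by (intro ennreal_leI) (simp add: \<eta>_def)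
    also have "\<dots> = sum f {i}" using that by (simp add: f_def)
    also have "\<dots> \<le> (\<Sum>i. f i)" by (intro sum_le_suminf) auto
    finally show False using f_less by simp
  qed
  have "\<exists>c. 0 \<le> c \<and> c < 1 \<and> circle_proj c = x i" for i
  proof -
    obtain c where "x i = circle_proj c" by (rule circle_proj_surj)
    then have "circle_proj (frac c) = x i" by (simp add: circle_proj_eq_iff frac_def)
    then show ?thesis using frac_ge_0[of c] frac_lt_1[of c] by blast
  qed
  then obtain c where c: "\<And>i. 0 \<le> c i" "\<And>i. c i < 1" "\<And>i. circle_proj (c i) = x i" by metis
  define l where "l i = real m * (2 * r i) powr \<delta>" for i
  have "\<exists>a. {t \<in> {0..<1}. \<bar>change_base m d t - (c i - of_int n)\<bar> < r i} \<subseteq> {a - l i .. a + l i}"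
    if "i \<in> I" for i and n :: int
    unfolding l_def
    by (rule change_base_preimage_ball[OF d m \<delta> r[OF that], of "c i - of_int n"]) (rule exI)
  then obtain a where a: "\<And>i n. i \<in> I \<Longrightarrow>
      {t \<in> {0..<1}. \<bar>change_base m d t - (c i - of_int n)\<bar> < r i} \<subseteq> {a i n - l i .. a i n + l i}"
    by metis
  define J where "J i = (if i \<in> I then \<Union>n\<in>{-1, 0, 1 :: int}. {a i n - l i .. a i n + l i} else {})" for i
  have sub: "{t \<in> {0..<1}. circle_proj (change_base m d t) \<in> Z} \<subseteq> (\<Union>i. J i)"
  proof
    fix t assume t: "t \<in> {t \<in> {0..<1}. circle_proj (change_base m d t) \<in> Z}"
    then obtain i where i: "i \<in> I" "dist (circle_proj (c i)) (circle_proj (change_base m d t)) < r i"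
      using cover c(3) by fastforce
    have "\<lfloor>t\<rfloor> = 0" using t by (intro floor_unique) auto
    then have "0 \<le> change_base m d t" "change_base m d t \<le> 1"
      using change_base_between[OF d m1 m(2), of t] by auto
    then obtain n where n: "n \<in> {-1, 0, 1 :: int}" "\<bar>change_base m d t - (c i - of_int n)\<bar> < r i"
      using circle_ball_lift[OF i(2) half[OF i(1)] c(1,2)] by blast
    then have "t \<in> {a i n - l i .. a i n + l i}" using a[OF i(1), of n] t by blast
    then show "t \<in> (\<Union>i. J i)" using i n(1) unfolding J_def by auto
  qed
  have J: "J i \<in> sets borel" for i by (simp add: J_def)
  have measure_J: "emeasure lborel (J i) \<le> ennreal K * f i" for i
  proof (cases "i \<in> I")
    case True
    have l: "0 \<le> l i" by (simp add: l_def)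
    have "emeasure lborel (J i) \<le> (\<Sum>n\<in>{-1, 0, 1 :: int}. emeasure lborel {a i n - l i .. a i n + l i})"
      using True unfolding J_def by (simp only: if_True) (intro emeasure_subadditive_finite; auto)
    also have "\<dots> = (\<Sum>n\<in>{-1, 0, 1 :: int}. ennreal (2 * l i))"
      using l by (intro sum.cong) auto
    also have "\<dots> = ennreal (\<Sum>n\<in>{-1, 0, 1 :: int}. 2 * l i)"
      using l by (intro sum_ennreal) auto
    also have "(\<Sum>n\<in>{-1, 0, 1 :: int}. 2 * l i) = K * r i powr \<delta>"
      using r[OF True] by (simp add: l_def K_def powr_mult)
    also have "ennreal (K * r i powr \<delta>) = ennreal K * f i"
      using True K by (simp add: f_def ennreal_mult)
    finally show ?thesis .
  qed (simp add: J_def)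
  have "(\<Union>i. J i) \<in> sets lborel" using J by auto
  then have "emeasure lebesgue (\<Union>i. J i) = emeasure lborel (\<Union>i. J i)" by simp
  also have "\<dots> \<le> (\<Sum>i. emeasure lborel (J i))"
    using J by (intro emeasure_subadditive_countably) auto
  also have "\<dots> \<le> (\<Sum>i. ennreal K * f i)"
    by (intro suminf_le measure_J) auto
  also have "\<dots> = ennreal K * (\<Sum>i. f i)" by simp
  also have "\<dots> \<le> ennreal K * ennreal (e / K)"
    using f_less by (intro mult_left_mono) (auto simp: \<eta>_def min_def split: if_splits dest: order.strict_implies_order order.trans intro: order.trans[OF less_imp_le ennreal_leI])
  also have "\<dots> = ennreal e" using K \<open>e > 0\<close> by (simp add: ennreal_mult[symmetric])
  finally have le: "emeasure lebesgue (\<Union>i. J i) \<le> ennreal e" .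
  have "(\<Union>i. J i) \<in> sets lebesgue" using J by (intro sets.countable_UN) (auto intro: sets_completionI_sets)
  then have "(\<Union>i. J i) \<in> lmeasurable"
    using le by (intro fmeasurableI) (auto simp: order_le_less_trans)
  moreover have "measure lebesgue (\<Union>i. J i) \<le> e"
    using le \<open>e > 0\<close> by (simp add: measure_def enn2real_leI)
  ultimately show "\<exists>T. {t \<in> {0..<1}. circle_proj (change_base m d t) \<in> Z} \<subseteq> T \<and>
      T \<in> lmeasurable \<and> measure lebesgue T \<le> e"
    using sub by blast
qed

section \<open>From degree at most \<open>m\<close> to degree exactly \<open>m\<close>\<close>

lemma cycle_closure_subset: "cycle_closure m d \<subseteq> closure (low_degree_points m d)"
  unfolding cycle_closure_def
proof (intro closure_mono subsetI)
  fix c assume "c \<in> {c. \<exists>C. cycle d C \<and> cycle_degree d C = m \<and> c \<in> C}"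
  then obtain C where C: "cycle d C" "cycle_degree d C = m" "c \<in> C" by auto
  have "\<exists>f. degree_map m f \<and> (\<forall>x\<in>C. f x = dmap d x)"
    unfolding C(2)[symmetric] cycle_degree_def
    by (rule LeastI_ex) (use degree_map_dmap in blast)
  then show "c \<in> low_degree_points m d" unfolding low_degree_points_def using C by blast
qed

text \<open>A cycle admitting a map of degree at most \<open>m\<close> has degree \<open>m\<close>
  or at most \<open>m - 1\<close>, and closure commutes with finite unions. The second part will be
  negligible, having smaller dimension.\<close>

lemma closure_low_degree_points_subset:
  "closure (low_degree_points m d) \<subseteq> cycle_closure m d \<union> closure (low_degree_points (m - 1) d)"
proof -
  have "low_degree_points m d \<subseteq>
      {c. \<exists>C. cycle d C \<and> cycle_degree d C = m \<and> c \<in> C} \<union> low_degree_points (m - 1) d"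
  proof
    fix c assume "c \<in> low_degree_points m d"
    then obtain C k f where C: "cycle d C" "c \<in> C" and k: "k \<le> m" "degree_map k f" "\<forall>x\<in>C. f x = dmap d x"
      unfolding low_degree_points_def by auto
    let ?P = "\<lambda>k. \<exists>f. degree_map k f \<and> (\<forall>x\<in>C. f x = dmap d x)"
    have "?P k" using k by blast
    then have "cycle_degree d C \<le> k" "?P (cycle_degree d C)"
      unfolding cycle_degree_def by (auto intro: Least_le LeastI)
    then show "c \<in> {c. \<exists>C. cycle d C \<and> cycle_degree d C = m \<and> c \<in> C} \<union> low_degree_points (m - 1) d"
    proof (cases "cycle_degree d C = m")
      case False
      then have "cycle_degree d C \<le> m - 1" using \<open>cycle_degree d C \<le> k\<close> k by simp
      then show ?thesis using C \<open>?P (cycle_degree d C)\<close> unfolding low_degree_points_def by blast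
    qed (use C in blast)
  qed
  then show ?thesis unfolding cycle_closure_def using closure_mono closure_Un by metis
qed

lemma hausdorff_content_mono:
  assumes "A \<subseteq> B"
  shows "hausdorff_content \<delta> A \<le> hausdorff_content \<delta> B"
  unfolding hausdorff_content_def
proof (rule Inf_superset_mono, clarify)
  fix I :: "nat set" and x r
  assume r: "\<forall>i\<in>I. r i > 0" and B: "B \<subseteq> (\<Union>i\<in>I. ball (x i) (r i))"
  have A: "A \<subseteq> (\<Union>i\<in>I. ball (x i) (r i))" using assms B by (rule order.trans)
  show "\<exists>(J :: nat set) y s. (\<Sum>\<^sub>\<infinity>i\<in>I. ennreal (r i powr \<delta>)) = (\<Sum>\<^sub>\<infinity>i\<in>J. ennreal (s i powr \<delta>)) \<and>
      (\<forall>i\<in>J. s i > 0) \<and> A \<subseteq> (\<Union>i\<in>J. ball (y i) (s i))"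
    by (intro exI[of _ I] exI[of _ x] exI[of _ r] conjI refl r A)
qed

theorem theorem2:
  fixes m d :: nat
  assumes "d > 1" and "1 \<le> m" and "m \<le> d"
  shows "hausdorff_dim (cycle_closure m d) = ereal (ln (real m) / ln (real d))"
proof (rule antisym)
  let ?s = "ln (real m) / ln (real d)"
  have s: "0 \<le> ?s" using assms by simp
  show "hausdorff_dim (cycle_closure m d) \<le> ereal ?s"
  proof (rule ereal_le_epsilon2)
    fix e :: real assume "e > 0"
    then have "hausdorff_content (?s + e) (closure (low_degree_points m d)) = 0"
      using assms by (intro hausdorff_content_low_degree_points) auto
    then have "hausdorff_content (?s + e) (cycle_closure m d) = 0"
      using hausdorff_content_mono[OF cycle_closure_subset] by (metis le_zero_eq)
    then show "hausdorff_dim (cycle_closure m d) \<le> ereal ?s + ereal e"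
      unfolding hausdorff_dim_def using s \<open>e > 0\<close> by (intro Inf_lower) auto
  qed
  show "ereal ?s \<le> hausdorff_dim (cycle_closure m d)"
    unfolding hausdorff_dim_def
  proof (intro Inf_greatest, clarify)
    fix \<delta> :: real assume \<delta>: "0 \<le> \<delta>" "hausdorff_content \<delta> (cycle_closure m d) = 0"
    show "ereal ?s \<le> ereal \<delta>"
    proof (rule ccontr)
      assume "\<not> ereal ?s \<le> ereal \<delta>"
      then have less: "\<delta> < ?s" by simp
      \<comment> \<open>For \<open>m = 1\<close> the value \<open>?s\<close> is \<open>0\<close>, so
        \<open>\<delta> < ?s\<close> is impossible.\<close>
      then have "m \<noteq> 1" using \<delta> by auto
      then have m: "2 \<le> m" using assms by simp
      have "ln (real (m - 1)) < ln (real m)" using m by simp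
      then have "ln (real (m - 1)) / ln (real d) < ?s" using assms by (simp add: divide_strict_right_mono)
      \<comment> \<open>The exponent here is \<open>?s\<close> and not \<open>\<delta>\<close>,
        since \<open>\<delta>\<close> may lie below \<open>ln (m - 1) / ln d\<close>; the vimage
        lemma admits both exponents.\<close>
      then have 0: "hausdorff_content ?s (closure (low_degree_points (m - 1) d)) = 0"
        using assms m by (intro hausdorff_content_low_degree_points) auto
      let ?T = "\<lambda>Z. {t \<in> {0..<1}. circle_proj (change_base m d t) \<in> Z}"
      have "negligible (?T (cycle_closure m d))"
        using less by (intro negligible_change_base_vimage[OF assms(1) m assms(3) \<delta>(1) _ \<delta>(2)]) simp
      then have "negligible (?T (cycle_closure m d) \<union> ?T (closure (low_degree_points (m - 1) d)))"
      proof (rule negligible_Un)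
        show "negligible (?T (closure (low_degree_points (m - 1) d)))"
          by (rule negligible_change_base_vimage[OF assms(1) m assms(3) s order_refl 0])
      qed
      moreover have "{0..<1} \<subseteq> ?T (cycle_closure m d) \<union> ?T (closure (low_degree_points (m - 1) d))"
      proof
        fix t :: real assume t: "t \<in> {0..<1}"
        then have "circle_proj (change_base m d t) \<in> closure (low_degree_points m d)"
          using change_base_in_closure[OF assms(1) m assms(3)] by simp
        from subsetD[OF closure_low_degree_points_subset this]
        show "t \<in> ?T (cycle_closure m d) \<union> ?T (closure (low_degree_points (m - 1) d))"
          using t by blast
      qed
      ultimately have "negligible {0..<1 :: real}" by (rule negligible_subset)
      moreover have "{0<..<1 :: real} \<subseteq> {0..<1}" by auto
      ultimately have "negligible {0<..<1 :: real}" by (rule negligible_subset)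
      then show False using open_not_negligible[of "{0<..<1 :: real}"] by simp
    qed
  qed
qed

end
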